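(* Let $\mathcal{H}$ be a real Hilbert space and let $(T_n)_{n \geq 0}$ be a sequence of nonexpansive operators $T_n : \mathcal{H} \to \mathcal{H}$ with $S := \bigcap_{n \geq 0} \operatorname{Fix} T_n \neq \emptyset$. Consider the iterative scheme $$x_{n+1} = \beta_n x_n + \lambda_n \big(T_n (\beta_n x_n) - \beta_n x_n\big) \quad \forall n \geq 0,$$ with starting point $x_0 \in \mathcal{H}$ and real sequences $(\lambda_n)_{n \geq 0}$, $(\beta_n)_{n \geq 0}$ satisfying the conditions: (i) $0 < \beta_n \leq 1$ for any $n \geq 0$, $\lim_{n \to +\infty} \beta_n = 1$, $\sum_{n \geq 0} (1 - \beta_n) = + \infty$ and $\sum_{n \geq 1} |\beta_n - \beta_{n-1}| < + \infty$; (ii) $0 < \lambda_n \leq 1$ for any $n \geq 0$, $\liminf_{n \to +\infty} \lambda_n > 0$ and $\sum_{n \geq 1} |\lambda_n - \lambda_{n-1}| < + \infty$; (iii) $\sum_{n \geq 1} \|T_n(\beta_{n-1} x_{n-1}) - T_{n-1}(\beta_{n-1} x_{n-1})\| < + \infty$. Then $\|x_n - T_n x_n\| \to 0$ as $n \to +\infty$. In addition, suppose that the following asymptotic condition holds: for any subsequences $(T_{n_k})_{k \geq 0}$ of $(T_n)_{n \geq 0}$ and $(x_{n_k})_{k \geq 0}$ of $(x_n)_{n \geq 0}$ (with the same indices $n_k$) with $x_{n_k} \rightharpoonup x \in \mathcal{H}$ and $x_{n_k} - T_{n_k} x_{n_k} \to 0$ as $k \to +\infty$, it holds $x \in \bigcap_{n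 \geq 0} \operatorname{Fix} T_n$. Then $(x_n)_{n \geq 0}$ converges strongly to $\operatorname{P}_S(0)$.
   Context: $\mathcal{H}$ is a real Hilbert space with inner product $\langle \cdot,\cdot\rangle$ and induced norm $\|\cdot\|$. The symbols $\rightharpoonup$ and $\to$ denote weak and strong (norm) convergence, respectively. A mapping $T : \mathcal{H} \to \mathcal{H}$ is nonexpansive if $\|Tx - Ty\| \leq \|x - y\|$ for all $x, y \in \mathcal{H}$. $\operatorname{Fix} T := \{x \in \mathcal{H} : T(x) = x\}$. For a nonempty convex closed set $C \subseteq \mathcal{H}$, $\operatorname{P}_C(x) := \operatorname{argmin}_{c \in C} \|x - c\|$ is the projection onto $C$; thus $\operatorname{P}_C(0)$ is the element of $C$ with minimum norm. *)

theory Defs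
  imports "HOL-Analysis.Analysis"
begin

text \<open>
  A real Hilbert space is a type of sort \<open>{real_inner, complete_space}\<close>; no
  finite-dimensionality or separability is imposed.
\<close>

definition nonexpansive :: "('a::real_normed_vector \<Rightarrow> 'a) \<Rightarrow> bool" where
  "nonexpansive T \<longleftrightarrow> (\<forall>x y. norm (T x - T y) \<le> norm (x - y))"

definition Fix :: "('a \<Rightarrow> 'a) \<Rightarrow> 'a set" where
  "Fix T = {x. T x = x}"

text \<open>Convergence of a sequence in the weak topology, i.e. the one generated by the
  functionals \<open>\<lambda>x. inner x u\<close>.\<close>

definition weakly_tendsto :: "(nat \<Rightarrow> 'a::real_inner) \<Rightarrow> 'a \<Rightarrow> bool"  (infix \<open>\<rightharpoonup>\<close> 60) where
  "X \<rightharpoonup> l \<longleftrightarrow> (\<forall>u. (\<lambda>n. inner (X n) u) \<longlonglongrightarrow> inner l u)"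

text \<open>
  The constant \<open>closest_point\<close> of the library is restricted to \<open>heine_borel\<close> spaces, which
  are finite-dimensional. For nonempty closed convex \<open>C\<close> in a Hilbert space the minimiser
  below exists and is unique; otherwise the value may be unspecified.
\<close>

definition metric_projection :: "'a::real_normed_vector set \<Rightarrow> 'a \<Rightarrow> 'a" where
  "metric_projection C x = arg_min_on (\<lambda>c. norm (x - c)) C"

end

theory Submission
  imports Defs "HOL-Library.Diagonal_Subsequence"
begin

text \<open>
  Each step first shrinks the iterate towards the origin by the factor \<open>\<beta> n\<close> and then applies the
  averaged operator \<open>u + lam n *\<^sub>R (T n u - u)\<close>, which is nonexpansive and fixes every point of \<open>S\<close>.
  The shrinking plays two roles. It turns the nonexpansive dynamics into a contraction with factor
  \<open>\<beta> n\<close>, and because the numbers \<open>1 - \<beta> n\<close> have a divergent sum, any initial discrepancy is damped to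
  zero. It also biases the iteration towards the origin, which selects the element of minimum norm among
  the common fixed points.

  Both halves of the theorem apply the same fact about real sequences,
  \<open>perturbed_contraction_tendsto_0\<close>. Used on the increments \<open>\<parallel>x (Suc n) - x n\<parallel>\<close>, with the total
  variation of the parameters and operators as summable error, it gives \<open>increments_tendsto_0\<close>.
  As the relaxation parameters stay away from zero, vanishing increments mean vanishing
  residuals (\<open>asymptotic_regularity\<close>).

  Used on \<open>\<parallel>x n - p\<parallel>\<^sup>2\<close>, where \<open>p\<close> is the projection of the origin onto \<open>S\<close>, it reduces strong
  convergence to the claim that \<open>inner p (p - x n)\<close> is asymptotically nonpositive
  (\<open>convergence_from_limsup_inner\<close>). That claim follows by weak compactness: the orbit is bounded,
  so a violating subsequence has a weak cluster point. By asymptotic regularity and the closedness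
  condition assumed for the second part, it lies in \<open>S\<close>, where the obtuse-angle property of the
  projection (\<open>metric_projection_variational\<close>) excludes it.

  The Hilbert space facts all come from minimising \<open>\<parallel>c\<parallel>\<^sup>2 - 2 * \<phi> c\<close> over a closed convex set
  (\<open>quadratic_attains_minimum\<close>): this yields the metric projection and Riesz representation, and
  through the latter the weakly convergent subsequences
  (\<open>bounded_imp_weakly_convergent_subsequence\<close>).
\<close>

section \<open>Perturbed contractive recursions\<close>

text \<open>
  Once \<open>b\<close> has dropped below \<open>\<epsilon>\<close>, the quantity \<open>a n - \<epsilon>\<close> is contracted by
  \<open>1 - \<gamma> n \<le> exp (- \<gamma> n)\<close> at each step, up to the summable error. Iterating, the initial value
  is damped by the exponential of minus the partial sums of \<open>\<gamma>\<close>, which tends to zero, while the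
  errors accumulate to no more than a tail of a convergent series.
\<close>

lemma perturbed_contraction_tendsto_0:
  fixes a b e \<gamma> :: "nat \<Rightarrow> real"
  assumes a_nonneg: "\<And>n. 0 \<le> a n"
    and rec: "\<And>n. a (Suc n) \<le> (1 - \<gamma> n) * a n + \<gamma> n * b n + e n"
    and \<gamma>_range: "\<And>n. 0 \<le> \<gamma> n \<and> \<gamma> n \<le> 1"
    and \<gamma>_sum: "filterlim (\<lambda>N. \<Sum>n<N. \<gamma> n) at_top sequentially"
    and b_limsup: "\<And>\<epsilon>. 0 < \<epsilon> \<Longrightarrow> \<forall>\<^sub>F n in sequentially. b n \<le> \<epsilon>"
    and e_nonneg: "\<And>n. 0 \<le> e n" and e_summable: "summable e"
  shows "a \<longlonglongrightarrow> 0"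
proof (rule LIMSEQ_I)
  fix r :: real assume "0 < r"
  define \<epsilon> where "\<epsilon> = r / 3"
  have "0 < \<epsilon>" using \<open>0 < r\<close> by (simp add: \<epsilon>_def)
  obtain N1 where N1: "\<And>n. N1 \<le> n \<Longrightarrow> b n \<le> \<epsilon>"
    using b_limsup[OF \<open>0 < \<epsilon>\<close>] by (auto simp: eventually_sequentially)
  obtain N2 where N2: "\<And>m n. N2 \<le> m \<Longrightarrow> norm (sum e {m..<n}) < \<epsilon>"
    using e_summable \<open>0 < \<epsilon>\<close> unfolding summable_Cauchy by meson
  define N where "N = max N1 N2"
  \<comment> \<open>The damping factors are kept on the starting value only; on the accumulated errors they are bounded by 1.\<close>
  have bound: "a (N + m) \<le> \<epsilon> + sum e {N..<N + m} + a N * exp (- (\<Sum>k=N..<N + m. \<gamma> k))" for m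
  proof (induction m)
    case 0
    then show ?case using \<open>0 < \<epsilon>\<close> by simp
  next
    case (Suc m)
    let ?n = "N + m" and ?E = "exp (- (\<Sum>k=N..<N + m. \<gamma> k))"
    have g: "0 \<le> \<gamma> ?n" "\<gamma> ?n \<le> 1" using \<gamma>_range by auto
    have "N1 \<le> ?n" by (simp add: N_def)
    have "a (Suc ?n) \<le> (1 - \<gamma> ?n) * a ?n + \<gamma> ?n * \<epsilon> + e ?n"
      using rec[of ?n] mult_left_mono[OF N1[OF \<open>N1 \<le> ?n\<close>] g(1)] by simp
    also have "\<dots> \<le> (1 - \<gamma> ?n) * (\<epsilon> + sum e {N..<?n} + a N * ?E) + \<gamma> ?n * \<epsilon> + e ?n"
      using mult_left_mono[OF Suc.IH, of "1 - \<gamma> ?n"] g by simp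
    also have "\<dots> = \<epsilon> + (1 - \<gamma> ?n) * sum e {N..<?n} + e ?n + a N * ((1 - \<gamma> ?n) * ?E)"
      by (simp add: algebra_simps)
    also have "\<dots> \<le> \<epsilon> + sum e {N..<?n} + e ?n + a N * (exp (- \<gamma> ?n) * ?E)"
    proof -
      have "(1 - \<gamma> ?n) * sum e {N..<?n} \<le> sum e {N..<?n}"
        using g e_nonneg by (intro mult_left_le_one_le) (auto intro: sum_nonneg)
      moreover have "a N * ((1 - \<gamma> ?n) * ?E) \<le> a N * (exp (- \<gamma> ?n) * ?E)"
        using exp_ge_add_one_self[of "- \<gamma> ?n"] a_nonneg by (intro mult_left_mono mult_right_mono) auto
      ultimately show ?thesis by simp
    qed
    finally show ?case by (simp add: exp_add[symmetric] exp_diff algebra_simps)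
  qed
  have "filterlim (\<lambda>n. - (\<Sum>k<N. \<gamma> k) + (\<Sum>k<n. \<gamma> k)) at_top sequentially"
    by (rule filterlim_tendsto_add_at_top[OF tendsto_const \<gamma>_sum])
  then have "filterlim (\<lambda>n. (\<Sum>k<N. \<gamma> k) - (\<Sum>k<n. \<gamma> k)) at_bot sequentially"
    by (simp add: filterlim_uminus_at_top)
  then have "(\<lambda>n. a N * exp ((\<Sum>k<N. \<gamma> k) - (\<Sum>k<n. \<gamma> k))) \<longlonglongrightarrow> a N * 0"
    by (intro tendsto_mult tendsto_const filterlim_compose[OF exp_at_bot])
  then obtain N3 where N3: "\<And>n. N3 \<le> n \<Longrightarrow> a N * exp ((\<Sum>k<N. \<gamma> k) - (\<Sum>k<n. \<gamma> k)) < \<epsilon>"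
    using order_tendstoD(2)[of _ "a N * 0" sequentially \<epsilon>] \<open>0 < \<epsilon>\<close>
    by (auto simp: eventually_sequentially)
  have "norm (a n - 0) < r" if "n \<ge> max N N3" for n
  proof -
    from that obtain m where n: "n = N + m" using le_Suc_ex[of N n] by auto
    have "(\<Sum>k<n. \<gamma> k) = (\<Sum>k<N. \<gamma> k) + (\<Sum>k=N..<N + m. \<gamma> k)"
      unfolding n lessThan_atLeast0 by (rule sum.atLeastLessThan_concat[symmetric]) auto
    then have "a N * exp (- (\<Sum>k=N..<N + m. \<gamma> k)) < \<epsilon>"
      using N3[of n] that by simp
    moreover have "sum e {N..<N + m} < \<epsilon>" using N2[of N "N + m"] by (simp add: N_def)
    ultimately show ?thesis using bound[of m] a_nonneg[of n] by (simp add: n \<epsilon>_def)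
  qed
  then show "\<exists>no. \<forall>n\<ge>no. norm (a n - 0) < r" by blast
qed

section \<open>Minimising a quadratic functional over a closed convex set\<close>

text \<open>
  The parallelogram law for the functional \<open>\<parallel>c\<parallel>\<^sup>2 - 2 * \<phi> c\<close> (the linear part cancels at the
  midpoint) forces every minimising sequence to be Cauchy. The linear term makes this one
  existence result serve two purposes: on an arbitrary closed convex set, with
  \<open>\<phi> = inner x\<close>, it yields the nearest point to \<open>x\<close>, and on a closed subspace it yields the Riesz
  representation of \<open>\<phi>\<close>.
\<close>

lemma quadratic_attains_minimum:
  fixes \<phi> :: "'a::{real_inner, complete_space} \<Rightarrow> real"
  assumes "bounded_linear \<phi>" "closed C" "convex C" "C \<noteq> {}"
  obtains z where "z \<in> C" "\<And>c. c \<in> C \<Longrightarrow> (norm z)\<^sup>2 - 2 * \<phi> z \<le> (norm c)\<^sup>2 - 2 * \<phi> c"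
proof -
  interpret bounded_linear \<phi> by fact
  define J where "J c = (norm c)\<^sup>2 - 2 * \<phi> c" for c
  obtain K where K: "\<And>c. norm (\<phi> c) \<le> norm c * K" using bounded by blast
  have "- K\<^sup>2 \<le> J c" for c
  proof -
    have "0 \<le> (norm c - K)\<^sup>2" by simp
    then show ?thesis using K[of c] by (simp add: J_def power2_eq_square algebra_simps)
  qed
  then have bdd: "bdd_below (J ` C)" by (intro bdd_belowI) auto
  define m where "m = Inf (J ` C)"
  have m_le: "m \<le> J c" if "c \<in> C" for c
    unfolding m_def using that by (intro cInf_lower bdd) auto
  have "\<exists>c\<in>C. J c < m + inverse (real (Suc n))" for n
    using cInf_lessD[of "J ` C" "m + inverse (real (Suc n))"] \<open>C \<noteq> {}\<close> by (auto simp: m_def)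
  then obtain c where c: "\<And>n. c n \<in> C" "\<And>n. J (c n) < m + inverse (real (Suc n))" by metis
  have gap: "(norm (c i - c j))\<^sup>2 \<le> 2 * inverse (real (Suc i)) + 2 * inverse (real (Suc j))" for i j
  proof -
    have "(1/2) *\<^sub>R c i + (1/2) *\<^sub>R c j \<in> C"
      using \<open>convex C\<close> c(1) by (auto simp: convex_def)
    then have "m \<le> J ((1/2) *\<^sub>R c i + (1/2) *\<^sub>R c j)" by (rule m_le)
    moreover have "(norm (c i - c j))\<^sup>2
        = 2 * J (c i) + 2 * J (c j) - 4 * J ((1/2) *\<^sub>R c i + (1/2) *\<^sub>R c j)"
      by (simp add: J_def power2_norm_eq_inner inner_simps add scale inner_commute algebra_simps)
    ultimately show ?thesis using c(2)[of i] c(2)[of j] by simp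
  qed
  have "Cauchy c"
  proof (rule metric_CauchyI)
    fix \<epsilon> :: real assume "0 < \<epsilon>"
    obtain N where N: "inverse (real (Suc N)) < \<epsilon>\<^sup>2 / 4"
      using reals_Archimedean[of "\<epsilon>\<^sup>2 / 4"] \<open>0 < \<epsilon>\<close> by auto
    have small: "inverse (real (Suc i)) < \<epsilon>\<^sup>2 / 4" if "N \<le> i" for i
    proof -
      have "inverse (real (Suc i)) \<le> inverse (real (Suc N))"
        using that by (intro le_imp_inverse_le) auto
      also note N
      finally show ?thesis .
    qed
    have "dist (c i) (c j) < \<epsilon>" if "N \<le> i" "N \<le> j" for i j
      unfolding dist_norm using gap[of i j] small[of i] small[of j] that \<open>0 < \<epsilon>\<close>
      by (intro power2_less_imp_less[of _ \<epsilon>]) auto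
    then show "\<exists>M. \<forall>i\<ge>M. \<forall>j\<ge>M. dist (c i) (c j) < \<epsilon>" by blast
  qed
  then obtain z where z: "c \<longlonglongrightarrow> z" using Cauchy_convergent convergent_def by blast
  have "z \<in> C" using closed_sequentially[OF \<open>closed C\<close>] c(1) z by blast
  have "(\<lambda>n. J (c n)) \<longlonglongrightarrow> J z"
    unfolding J_def by (intro tendsto_intros z tendsto)
  moreover have "(\<lambda>n. m + inverse (real (Suc n))) \<longlonglongrightarrow> m + 0"
    by (intro tendsto_add tendsto_const LIMSEQ_inverse_real_of_nat)
  ultimately have "J z \<le> m + 0" by (rule LIMSEQ_le) (use c(2) in \<open>auto intro: less_imp_le\<close>)
  then show thesis using that[OF \<open>z \<in> C\<close>] m_le unfolding J_def by force
qed

text \<open>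
  First-order optimality: moving from \<open>z\<close> a fraction \<open>t\<close> of the way to \<open>c\<close> stays in \<open>C\<close> and changes
  the functional by \<open>t * (2 * A + t * \<parallel>c - z\<parallel>\<^sup>2)\<close>, where
  \<open>A = inner z (c - z) - \<phi> (c - z)\<close>; letting
  \<open>t\<close> decrease to zero gives \<open>0 \<le> A\<close>.
\<close>

lemma quadratic_minimum_variational:
  fixes \<phi> :: "'a::real_inner \<Rightarrow> real"
  assumes "linear \<phi>" "convex C" "z \<in> C" "c \<in> C"
    and min: "\<And>c. c \<in> C \<Longrightarrow> (norm z)\<^sup>2 - 2 * \<phi> z \<le> (norm c)\<^sup>2 - 2 * \<phi> c"
  shows "\<phi> (c - z) \<le> inner z (c - z)"
proof -
  interpret linear \<phi> by fact
  define d where "d = c - z"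
  define A where "A = inner z d - \<phi> d"
  have step: "0 \<le> 2 * A + t * (norm d)\<^sup>2" if "0 < t" "t \<le> 1" for t
  proof -
    have "z + t *\<^sub>R d = (1 - t) *\<^sub>R z + t *\<^sub>R c" by (simp add: d_def algebra_simps)
    then have "z + t *\<^sub>R d \<in> C" using assms(2-4) that by (simp add: convex_alt)
    from min[OF this] have "0 \<le> t * (2 * A + t * (norm d)\<^sup>2)"
      by (simp add: A_def power2_norm_eq_inner inner_simps add scale inner_commute algebra_simps)
    then show ?thesis using \<open>0 < t\<close> by (simp add: zero_le_mult_iff)
  qed
  have "((\<lambda>t. 2 * A + t * (norm d)\<^sup>2) \<longlongrightarrow> 2 * A + 0 * (norm d)\<^sup>2) (at_right 0)"
    by (intro tendsto_intros)
  moreover have "\<forall>\<^sub>F t in at_right (0::real). 0 \<le> 2 * A + t * (norm d)\<^sup>2"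
    unfolding eventually_at_right_field by (rule exI[of _ 1]) (use step in auto)
  ultimately have "0 \<le> 2 * A + 0 * (norm d)\<^sup>2"
    by (rule tendsto_lowerbound) simp
  then show ?thesis by (simp add: A_def d_def)
qed

text \<open>
  On a subspace the admissible directions at the minimiser come in pairs \<open>w\<close>, \<open>- w\<close>, so the
  variational inequality becomes an equation. With \<open>W = UNIV\<close> this is the Riesz representation
  theorem; with \<open>\<phi> = inner u\<close> the point \<open>z\<close> is the orthogonal projection of \<open>u\<close> onto \<open>W\<close>.
\<close>

lemma riesz_on_closed_subspace:
  fixes \<phi> :: "'a::{real_inner, complete_space} \<Rightarrow> real"
  assumes "bounded_linear \<phi>" "closed W" "subspace W"
  obtains z where "z \<in> W" "\<And>w. w \<in> W \<Longrightarrow> \<phi> w = inner z w"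
proof -
  have "convex W" "W \<noteq> {}"
    using \<open>subspace W\<close> subspace_imp_convex subspace_0 by auto
  then obtain z where z: "z \<in> W" "\<And>c. c \<in> W \<Longrightarrow> (norm z)\<^sup>2 - 2 * \<phi> z \<le> (norm c)\<^sup>2 - 2 * \<phi> c"
    using quadratic_attains_minimum[OF assms(1,2)] by blast
  interpret bounded_linear \<phi> by fact
  have le: "\<phi> w \<le> inner z w" if "w \<in> W" for w
    using quadratic_minimum_variational[OF linear_axioms \<open>convex W\<close> z(1) _ z(2), of "z + w"]
      subspace_add[OF \<open>subspace W\<close> z(1) that] by simp
  have "\<phi> w = inner z w" if "w \<in> W" for w
    using le[OF that] le[of "- w"] subspace_neg[OF \<open>subspace W\<close> that] by (simp add: neg)
  with z(1) that show thesis by blast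
qed

text \<open>
  Since \<open>\<parallel>x - c\<parallel>\<^sup>2\<close> differs from the quadratic functional with \<open>\<phi> = inner x\<close> by the constant
  \<open>\<parallel>x\<parallel>\<^sup>2\<close>, both the existence of the projection and its obtuse-angle property carry over.
\<close>

lemma metric_projection_variational:
  fixes C :: "'a::{real_inner, complete_space} set"
  assumes "closed C" "convex C" "C \<noteq> {}"
  shows "metric_projection C x \<in> C"
    and "\<And>c. c \<in> C \<Longrightarrow> inner (x - metric_projection C x) (c - metric_projection C x) \<le> 0"
proof -
  let ?p = "metric_projection C x"
  have expand: "(norm (x - c))\<^sup>2 = ((norm c)\<^sup>2 - 2 * inner x c) + (norm x)\<^sup>2" for c
    by (simp add: power2_norm_eq_inner inner_simps inner_commute)
  obtain z where "z \<in> C" "\<And>c. c \<in> C \<Longrightarrow> (norm z)\<^sup>2 - 2 * inner x z \<le> (norm c)\<^sup>2 - 2 * inner x c"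
    using quadratic_attains_minimum[OF bounded_linear_inner_right assms] by blast
  then have "is_arg_min (\<lambda>c. norm (x - c)) (\<lambda>c. c \<in> C) z"
    unfolding is_arg_min_linorder
    by (metis expand add_right_mono norm_ge_zero power2_le_imp_le)
  then have "is_arg_min (\<lambda>c. norm (x - c)) (\<lambda>c. c \<in> C) ?p"
    unfolding metric_projection_def arg_min_on_def arg_min_def by (rule someI)
  then have p: "?p \<in> C" and min: "\<And>c. c \<in> C \<Longrightarrow> norm (x - ?p) \<le> norm (x - c)"
    unfolding is_arg_min_linorder by auto
  show "?p \<in> C" by (rule p)
  have "(norm ?p)\<^sup>2 - 2 * inner x ?p \<le> (norm c)\<^sup>2 - 2 * inner x c" if "c \<in> C" for c
    using power_mono[OF min[OF that], of 2] by (simp add: expand)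
  then have "inner x (c - ?p) \<le> inner ?p (c - ?p)" if "c \<in> C" for c
    by (intro quadratic_minimum_variational[OF _ \<open>convex C\<close> p that])
      (auto intro: bounded_linear.linear bounded_linear_inner_right)
  then show "inner (x - ?p) (c - ?p) \<le> 0" if "c \<in> C" for c
    using that by (simp add: inner_diff_left)
qed

section \<open>Weak sequential compactness of bounded sequences\<close>

text \<open>
  For bounded \<open>y\<close>, replacing \<open>u\<close> by a nearby \<open>v\<close> changes all the numbers \<open>inner (y k) u\<close> uniformly
  little, so the Cauchy property passes from the approximating vectors to their limit.
\<close>

lemma closed_inner_convergent:
  fixes y :: "nat \<Rightarrow> 'a::real_inner"
  assumes M: "\<And>k. norm (y k) \<le> M"
  shows "closed {u. convergent (\<lambda>k. inner (y k) u)}" (is "closed ?W")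
proof -
  have M0: "0 \<le> M" using M[of 0] norm_ge_zero order_trans by blast
  have "u \<in> ?W" if "v \<longlonglongrightarrow> u" "\<And>n. v n \<in> ?W" for u v
  proof -
    have "Cauchy (\<lambda>k. inner (y k) u)"
    proof (rule metric_CauchyI)
      fix \<epsilon> :: real assume "0 < \<epsilon>"
      then have "0 < \<epsilon> / (4 * (M + 1))" using M0 by simp
      then obtain n where n: "norm (v n - u) < \<epsilon> / (4 * (M + 1))"
        using LIMSEQ_D[OF \<open>v \<longlonglongrightarrow> u\<close>] by blast
      have near: "\<bar>inner (y k) u - inner (y k) (v n)\<bar> \<le> \<epsilon> / 4" for k
      proof -
        have "\<bar>inner (y k) u - inner (y k) (v n)\<bar> = \<bar>inner (y k) (v n - u)\<bar>"
          by (simp add: inner_simps)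
        also have "\<dots> \<le> norm (y k) * norm (v n - u)" by (rule Cauchy_Schwarz_ineq2)
        also have "\<dots> \<le> (M + 1) * (\<epsilon> / (4 * (M + 1)))"
          using M[of k] n M0 by (intro mult_mono) auto
        also have "\<dots> = \<epsilon> / 4" using M0 by (simp add: field_simps)
        finally show ?thesis .
      qed
      have "Cauchy (\<lambda>k. inner (y k) (v n))"
        using that(2)[of n] convergent_Cauchy by auto
      then obtain N where N: "\<And>i j. N \<le> i \<Longrightarrow> N \<le> j \<Longrightarrow>
          dist (inner (y i) (v n)) (inner (y j) (v n)) < \<epsilon> / 2"
        using \<open>0 < \<epsilon>\<close> by (metis metric_CauchyD half_gt_zero)
      have "dist (inner (y i) u) (inner (y j) u) < \<epsilon>" if "N \<le> i" "N \<le> j" for i j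
        using near[of i] near[of j] N[OF that] unfolding dist_real_def by linarith
      then show "\<exists>N. \<forall>i\<ge>N. \<forall>j\<ge>N. dist (inner (y i) u) (inner (y j) u) < \<epsilon>" by blast
    qed
    then show ?thesis by (simp add: real_Cauchy_convergent)
  qed
  then show ?thesis by (auto simp: closed_sequential_limits)
qed

text \<open>
  A diagonal argument gives a subsequence \<open>y\<close> whose inner products with every member of the
  original sequence converge. The vectors \<open>u\<close> for which \<open>inner (y k) u\<close> converges then form a closed
  subspace \<open>W\<close> containing all the \<open>y k\<close>. A vector orthogonal to \<open>W\<close> is orthogonal to every \<open>y k\<close>, so
  the inner products of \<open>y k\<close> with \<open>u\<close> and with its projection onto \<open>W\<close> agree, and \<open>W\<close> is the whole
  space. The limit functional is bounded, and its Riesz representative is the weak limit.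
\<close>

lemma bounded_imp_weakly_convergent_subsequence:
  fixes x :: "nat \<Rightarrow> 'a::{real_inner, complete_space}"
  assumes M: "\<And>n. norm (x n) \<le> M"
  obtains r z where "strict_mono r" "(\<lambda>k. x (r k)) \<rightharpoonup> z"
proof -
  have M0: "0 \<le> M" using M[of 0] norm_ge_zero order_trans by blast
  interpret subseqs "\<lambda>m s. convergent (\<lambda>k. inner (x (s k)) (x m))"
  proof
    fix m :: nat and s :: "nat \<Rightarrow> nat" assume "strict_mono s"
    have "\<bar>inner (x (s k)) (x m)\<bar> \<le> M * M" for k
      using Cauchy_Schwarz_ineq2[of "x (s k)" "x m"] mult_mono[OF M[of "s k"] M[of m] M0] by simp
    then have "bounded (range (\<lambda>k. inner (x (s k)) (x m)))"
      by (auto simp: bounded_iff)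
    then show "\<exists>r. strict_mono r \<and> convergent (\<lambda>k. inner (x ((s \<circ> r) k)) (x m))"
      using bounded_imp_convergent_subsequence by (fastforce simp: convergent_def o_def)
  qed
  define y where "y k = x (diagseq k)" for k
  have conv_x: "convergent (\<lambda>k. inner (y k) (x m))" for m
  proof -
    have "convergent (\<lambda>k. inner (x ((diagseq \<circ> (+) (Suc m)) k)) (x m))"
    proof (rule diagseq_holds)
      fix r s and n assume "strict_mono (r :: nat \<Rightarrow> nat)" "convergent (\<lambda>k. inner (x (s k)) (x n))"
      then show "convergent (\<lambda>k. inner (x ((s \<circ> r) k)) (x n))"
        using convergent_subseq_convergent[of "\<lambda>k. inner (x (s k)) (x n)" r] by (simp add: o_def)
    qed
    then have "convergent (\<lambda>k. inner (y (k + Suc m)) (x m))"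
      by (simp add: y_def o_def add.commute)
    then show ?thesis by (subst (asm) convergent_ignore_initial_segment)
  qed
  define W where "W = {u. convergent (\<lambda>k. inner (y k) u)}"
  have "closed W" unfolding W_def by (rule closed_inner_convergent[where M = M]) (simp add: y_def M)
  have "subspace W"
    unfolding W_def
    by (auto simp: subspace_def inner_simps convergent_const intro!: convergent_add convergent_mult)
  have y_in: "y k \<in> W" for k unfolding W_def using conv_x by (simp add: y_def)
  have all: "u \<in> W" for u
  proof -
    obtain w where w: "w \<in> W" "\<And>v. v \<in> W \<Longrightarrow> inner u v = inner w v"
      using riesz_on_closed_subspace[OF bounded_linear_inner_right \<open>closed W\<close> \<open>subspace W\<close>, of u]
      by metis
    have "(\<lambda>k. inner (y k) u) = (\<lambda>k. inner (y k) w)"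
      using w(2)[OF y_in] by (simp add: inner_commute)
    with w(1) show ?thesis by (simp add: W_def)
  qed
  define \<phi> where "\<phi> u = lim (\<lambda>k. inner (y k) u)" for u
  have lim: "(\<lambda>k. inner (y k) u) \<longlonglongrightarrow> \<phi> u" for u
    using all[of u] by (simp add: W_def \<phi>_def convergent_LIMSEQ_iff)
  have "bounded_linear \<phi>"
  proof (rule bounded_linear_intro[where K = M])
    fix u v :: 'a and t :: real
    show "\<phi> (u + v) = \<phi> u + \<phi> v"
      using tendsto_add[OF lim[of u] lim[of v]] lim[of "u + v"]
      by (auto simp: inner_simps intro: LIMSEQ_unique)
    show "\<phi> (t *\<^sub>R u) = t *\<^sub>R \<phi> u"
      using tendsto_mult_left[OF lim[of u], of t] lim[of "t *\<^sub>R u"]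
      by (auto simp: inner_simps intro: LIMSEQ_unique)
    have "\<bar>inner (y k) u\<bar> \<le> norm u * M" for k
      using Cauchy_Schwarz_ineq2[of "y k" u] mult_right_mono[OF M[of "diagseq k"], of "norm u"]
      by (simp add: y_def mult.commute)
    then show "norm (\<phi> u) \<le> norm u * M"
      using LIMSEQ_le_const2[OF tendsto_norm[OF lim[of u]]] by auto
  qed
  then obtain z where z: "\<And>u. \<phi> u = inner z u"
    using riesz_on_closed_subspace[of \<phi> UNIV] by auto
  show thesis
  proof (rule that[OF subseq_diagseq])
    show "(\<lambda>k. x (diagseq k)) \<rightharpoonup> z"
      using lim by (simp add: weakly_tendsto_def y_def z)
  qed
qed

section \<open>Fixed points of nonexpansive maps\<close>

lemma nonexpansiveD: "nonexpansive T \<Longrightarrow> norm (T u - T v) \<le> norm (u - v)"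
  by (simp add: nonexpansive_def)

lemma closed_Fix_nonexpansive:
  fixes T :: "'a::real_normed_vector \<Rightarrow> 'a"
  assumes "nonexpansive T"
  shows "closed (Fix T)"
proof -
  have "1-lipschitz_on UNIV T"
    using nonexpansiveD[OF assms] by (auto simp: lipschitz_on_def dist_norm)
  then have "continuous_on UNIV T" by (rule lipschitz_on_continuous_on)
  then show ?thesis unfolding Fix_def by (intro closed_Collect_eq continuous_on_id)
qed

text \<open>
  For \<open>z\<close> between two fixed points \<open>p\<close> and \<open>q\<close>, the image \<open>T z\<close> is no farther from either of
  them than \<open>z\<close> is. As the distances of \<open>z\<close> to \<open>p\<close> and \<open>q\<close> already add up to the distance
  between \<open>p\<close> and \<open>q\<close>, strict convexity of the norm leaves only \<open>T z = z\<close>. Quantitatively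
  this is Stewart's identity for \<open>\<parallel>T z - z\<parallel>\<^sup>2\<close>.
\<close>

lemma convex_Fix_nonexpansive:
  fixes T :: "'a::real_inner \<Rightarrow> 'a"
  assumes "nonexpansive T"
  shows "convex (Fix T)"
  unfolding convex_alt
proof (intro ballI allI impI)
  fix p q :: 'a and t :: real
  assume pq: "p \<in> Fix T" "q \<in> Fix T" and t: "0 \<le> t \<and> t \<le> 1"
  define z where "z = (1 - t) *\<^sub>R p + t *\<^sub>R q"
  define d where "d = (norm (p - q))\<^sup>2"
  have "norm (T z - p) \<le> norm (z - p)" "norm (T z - q) \<le> norm (z - q)"
    using nonexpansiveD[OF assms, of z p] nonexpansiveD[OF assms, of z q] pq by (auto simp: Fix_def)
  moreover have "z - p = t *\<^sub>R (q - p)" "z - q = (1 - t) *\<^sub>R (p - q)"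
    by (simp_all add: z_def algebra_simps)
  ultimately have le: "(norm (T z - p))\<^sup>2 \<le> t\<^sup>2 * d" "(norm (T z - q))\<^sup>2 \<le> (1 - t)\<^sup>2 * d"
    using t by (auto simp: d_def norm_minus_commute power_mult_distrib[symmetric] intro!: power_mono)
  have "(norm (T z - z))\<^sup>2 = (1 - t) * (norm (T z - p))\<^sup>2 + t * (norm (T z - q))\<^sup>2 - t * (1 - t) * d"
    by (simp add: z_def d_def power2_norm_eq_inner inner_simps inner_commute algebra_simps)
  also have "\<dots> \<le> (1 - t) * (t\<^sup>2 * d) + t * ((1 - t)\<^sup>2 * d) - t * (1 - t) * d"
    using t le by (intro diff_right_mono add_mono mult_left_mono) auto
  also have "\<dots> = 0" by (simp add: power2_eq_square algebra_simps)
  finally show "z \<in> Fix T" by (simp add: Fix_def)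
qed

lemma relaxation_nonexpansive:
  fixes T :: "'a::real_normed_vector \<Rightarrow> 'a"
  assumes "nonexpansive T" "0 \<le> l" "l \<le> 1"
  shows "nonexpansive (\<lambda>u. u + l *\<^sub>R (T u - u))"
  unfolding nonexpansive_def
proof (intro allI)
  fix u v
  have "(u + l *\<^sub>R (T u - u)) - (v + l *\<^sub>R (T v - v)) = (1 - l) *\<^sub>R (u - v) + l *\<^sub>R (T u - T v)"
    by (simp add: algebra_simps)
  also have "norm \<dots> \<le> (1 - l) * norm (u - v) + l * norm (T u - T v)"
    using assms(2,3) by (intro norm_triangle_le) simp
  also have "\<dots> \<le> (1 - l) * norm (u - v) + l * norm (u - v)"
    using assms nonexpansiveD by (intro add_left_mono mult_left_mono) auto
  finally show "norm ((u + l *\<^sub>R (T u - u)) - (v + l *\<^sub>R (T v - v))) \<le> norm (u - v)"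
    by (simp add: algebra_simps)
qed

section \<open>The regularised Krasnoselskii-Mann iteration\<close>

locale tikhonov_krasnoselskii_mann =
  fixes T :: "nat \<Rightarrow> 'a::{real_inner, complete_space} \<Rightarrow> 'a"
    and x :: "nat \<Rightarrow> 'a"
    and \<beta> lam :: "nat \<Rightarrow> real"
  assumes nonexp: "\<And>n. nonexpansive (T n)"
    and common_fixed_point: "(\<Inter>n. Fix (T n)) \<noteq> {}"
    and iter: "\<And>n. x (Suc n) =
      \<beta> n *\<^sub>R x n + lam n *\<^sub>R (T n (\<beta> n *\<^sub>R x n) - \<beta> n *\<^sub>R x n)"
    and beta_range: "\<And>n. 0 < \<beta> n \<and> \<beta> n \<le> 1"
    and lam_range: "\<And>n. 0 < lam n \<and> lam n \<le> 1"
begin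

definition shrunk :: "nat \<Rightarrow> 'a" where
  "shrunk n = \<beta> n *\<^sub>R x n"

definition relaxed :: "nat \<Rightarrow> 'a \<Rightarrow> 'a" where
  "relaxed n u = u + lam n *\<^sub>R (T n u - u)"

lemma x_Suc: "x (Suc n) = relaxed n (shrunk n)"
  by (simp add: iter relaxed_def shrunk_def)

lemma relaxed_nonexpansive: "norm (relaxed n u - relaxed n v) \<le> norm (u - v)"
  using relaxation_nonexpansive[OF nonexp, of "lam n" n] lam_range[of n]
  by (simp add: nonexpansive_def relaxed_def)

lemma dist_fixed_point_step:
  assumes "p \<in> (\<Inter>n. Fix (T n))"
  shows "norm (x (Suc n) - p) \<le> norm (shrunk n - p)"
proof -
  have "T n p = p" using assms by (simp add: Fix_def)
  then have "relaxed n p = p" by (simp add: relaxed_def)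
  then show ?thesis using relaxed_nonexpansive[of n "shrunk n" p] by (simp add: x_Suc)
qed

lemma shrunk_norm_le: "norm (shrunk n) \<le> norm (x n)"
  using beta_range[of n] mult_left_le_one_le[of "norm (x n)" "\<beta> n"] by (simp add: shrunk_def)

text \<open>
  Around a common fixed point \<open>p\<close>, the new error is at most the convex combination of the old error
  and \<open>\<parallel>p\<parallel>\<close> with weights \<open>\<beta> n\<close> and \<open>1 - \<beta> n\<close>, because shrinking pulls towards the origin and
  relaxed operators fix \<open>p\<close>.
\<close>

lemma x_bounded: "\<exists>M. \<forall>n. norm (x n) \<le> M"
proof -
  obtain p where p: "p \<in> (\<Inter>n. Fix (T n))" using common_fixed_point by blast
  define B where "B = max (norm (x 0 - p)) (norm p)"
  have "norm (x n - p) \<le> B" for n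
  proof (induction n)
    case (Suc n)
    have "shrunk n - p = \<beta> n *\<^sub>R (x n - p) - (1 - \<beta> n) *\<^sub>R p"
      by (simp add: shrunk_def algebra_simps)
    also have "norm \<dots> \<le> \<beta> n * norm (x n - p) + (1 - \<beta> n) * norm p"
      using beta_range[of n] norm_triangle_ineq4[of "\<beta> n *\<^sub>R (x n - p)" "(1 - \<beta> n) *\<^sub>R p"] by simp
    also have "\<dots> \<le> \<beta> n * B + (1 - \<beta> n) * B"
      using beta_range[of n] Suc.IH by (intro add_mono mult_left_mono) (auto simp: B_def)
    finally show ?case using dist_fixed_point_step[OF p, of n] by (simp add: algebra_simps)
  qed (simp add: B_def)
  then have "norm (x n) \<le> B + norm p" for n
    using norm_triangle_ineq[of "x n - p" p] by (auto intro: order_trans)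
  then show ?thesis by blast
qed

lemma T_displacement_le:
  assumes "p \<in> (\<Inter>n. Fix (T n))"
  shows "norm (T n u - u) \<le> 2 * norm (u - p)"
proof -
  have "T n p = p" using assms by (simp add: Fix_def)
  then have "norm (T n u - p) \<le> norm (u - p)" using nonexpansiveD[OF nonexp, of n u p] by simp
  then show ?thesis
    using norm_triangle_ineq4[of "T n u - p" "u - p"] by simp
qed

text \<open>
  Consecutive increments are contracted by \<open>\<beta> (Suc n)\<close>, since the factor survives the nonexpansive
  operator. The remaining change comes from varying \<open>\<beta>\<close>, \<open>lam\<close> and \<open>T\<close>; on the bounded orbit each of
  these contributions is summable, so the perturbed contraction lemma applies with
  \<open>\<gamma> n = 1 - \<beta> (Suc n)\<close>.
\<close>

lemma increments_tendsto_0: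
  assumes beta_sum: "filterlim (\<lambda>N. \<Sum>n<N. 1 - \<beta> n) at_top sequentially"
    and beta_var: "summable (\<lambda>n. \<bar>\<beta> (Suc n) - \<beta> n\<bar>)"
    and lam_var: "summable (\<lambda>n. \<bar>lam (Suc n) - lam n\<bar>)"
    and T_var: "summable (\<lambda>n. norm (T (Suc n) (shrunk n) - T n (shrunk n)))"
  shows "(\<lambda>n. norm (x (Suc n) - x n)) \<longlonglongrightarrow> 0"
proof -
  obtain p where p: "p \<in> (\<Inter>n. Fix (T n))" using common_fixed_point by blast
  obtain M where M: "\<And>n. norm (x n) \<le> M" using x_bounded by blast
  have M0: "0 \<le> M" using M[of 0] norm_ge_zero order_trans by blast
  define L where "L = 2 * (M + norm p)"
  define e where "e n = \<bar>\<beta> (Suc n) - \<beta> n\<bar> * M + \<bar>lam (Suc n) - lam n\<bar> * L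
      + norm (T (Suc n) (shrunk n) - T n (shrunk n))" for n
  have "0 \<le> L" using M0 by (simp add: L_def)
  have residual: "norm (T n (shrunk n) - shrunk n) \<le> L" for n
    using T_displacement_le[OF p, of n "shrunk n"] norm_triangle_ineq4[of "shrunk n" p]
      shrunk_norm_le[of n] M[of n] by (simp add: L_def)
  \<comment> \<open>Change of the point at which the operator is evaluated.\<close>
  have input: "norm (shrunk (Suc n) - shrunk n)
      \<le> \<beta> (Suc n) * norm (x (Suc n) - x n) + \<bar>\<beta> (Suc n) - \<beta> n\<bar> * M" for n
  proof -
    have "shrunk (Suc n) - shrunk n
        = \<beta> (Suc n) *\<^sub>R (x (Suc n) - x n) + (\<beta> (Suc n) - \<beta> n) *\<^sub>R x n"
      by (simp add: shrunk_def algebra_simps)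
    also have "norm \<dots> \<le> \<beta> (Suc n) * norm (x (Suc n) - x n) + \<bar>\<beta> (Suc n) - \<beta> n\<bar> * norm (x n)"
      using beta_range[of "Suc n"] by (intro norm_triangle_le) simp
    finally show ?thesis using mult_left_mono[OF M[of n], of "\<bar>\<beta> (Suc n) - \<beta> n\<bar>"] by simp
  qed
  \<comment> \<open>Change of the operator while the evaluation point stays the same.\<close>
  have operator: "norm (relaxed (Suc n) (shrunk n) - relaxed n (shrunk n))
      \<le> \<bar>lam (Suc n) - lam n\<bar> * L + norm (T (Suc n) (shrunk n) - T n (shrunk n))" for n
  proof -
    have "relaxed (Suc n) (shrunk n) - relaxed n (shrunk n)
        = (lam (Suc n) - lam n) *\<^sub>R (T n (shrunk n) - shrunk n)
          + lam (Suc n) *\<^sub>R (T (Suc n) (shrunk n) - T n (shrunk n))"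
      by (simp add: relaxed_def algebra_simps)
    also have "norm \<dots> \<le> \<bar>lam (Suc n) - lam n\<bar> * norm (T n (shrunk n) - shrunk n)
          + lam (Suc n) * norm (T (Suc n) (shrunk n) - T n (shrunk n))"
      using lam_range[of "Suc n"] by (intro norm_triangle_le) simp
    also have "\<dots> \<le> \<bar>lam (Suc n) - lam n\<bar> * L + 1 * norm (T (Suc n) (shrunk n) - T n (shrunk n))"
      using lam_range[of "Suc n"] residual[of n] by (intro add_mono mult_left_mono mult_right_mono) auto
    finally show ?thesis by simp
  qed
  show ?thesis
  proof (rule perturbed_contraction_tendsto_0[where \<gamma> = "\<lambda>n. 1 - \<beta> (Suc n)" and b = "\<lambda>_. 0" and e = e])
    fix n
    show "norm (x (Suc (Suc n)) - x (Suc n))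
        \<le> (1 - (1 - \<beta> (Suc n))) * norm (x (Suc n) - x n) + (1 - \<beta> (Suc n)) * 0 + e n"
      using norm_triangle_ineq[of "relaxed (Suc n) (shrunk (Suc n)) - relaxed (Suc n) (shrunk n)"
          "relaxed (Suc n) (shrunk n) - relaxed n (shrunk n)"]
        relaxed_nonexpansive[of "Suc n" "shrunk (Suc n)" "shrunk n"] input[of n] operator[of n]
      by (simp add: x_Suc e_def)
    show "0 \<le> 1 - \<beta> (Suc n) \<and> 1 - \<beta> (Suc n) \<le> 1" using beta_range[of "Suc n"] by simp
    show "0 \<le> e n" using M0 \<open>0 \<le> L\<close> by (simp add: e_def)
  next
    have "filterlim (\<lambda>N. \<Sum>n<Suc N. 1 - \<beta> n) at_top sequentially"
      using beta_sum by (rule filterlim_compose[OF _ filterlim_Suc])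
    then have "filterlim (\<lambda>N. - (1 - \<beta> 0) + (\<Sum>n<Suc N. 1 - \<beta> n)) at_top sequentially"
      by (rule filterlim_tendsto_add_at_top[OF tendsto_const])
    then show "filterlim (\<lambda>N. \<Sum>n<N. 1 - \<beta> (Suc n)) at_top sequentially"
      by (simp only: sum.lessThan_Suc_shift) simp
    show "summable e"
      unfolding e_def by (intro summable_add summable_mult2 beta_var lam_var T_var)
  qed simp_all
qed

lemma shrunk_minus_x_tendsto_0:
  assumes "\<beta> \<longlonglongrightarrow> 1"
  shows "(\<lambda>n. norm (shrunk n - x n)) \<longlonglongrightarrow> 0"
proof -
  obtain M where M: "\<And>n. norm (x n) \<le> M" using x_bounded by blast
  have "(\<lambda>n. (1 - \<beta> n) * M) \<longlonglongrightarrow> (1 - 1) * M" by (intro tendsto_intros assms)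
  then have lim: "(\<lambda>n. (1 - \<beta> n) * M) \<longlonglongrightarrow> 0" by simp
  have "norm (shrunk n - x n) \<le> (1 - \<beta> n) * M" for n
  proof -
    have "shrunk n - x n = - ((1 - \<beta> n) *\<^sub>R x n)" by (simp add: shrunk_def algebra_simps)
    then have "norm (shrunk n - x n) = (1 - \<beta> n) * norm (x n)" using beta_range[of n] by simp
    then show ?thesis using mult_left_mono[OF M[of n], of "1 - \<beta> n"] beta_range[of n] by simp
  qed
  then show ?thesis by (intro tendsto_sandwich[OF _ _ tendsto_const lim]) auto
qed

text \<open>
  The residual at the shrunk point is the step \<open>x (Suc n) - shrunk n\<close> divided by \<open>lam n\<close>, and \<open>lam\<close>
  is eventually bounded away from zero. As \<open>shrunk n - x n\<close> vanishes, that step vanishes together with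
  the increments, and nonexpansiveness transfers the residual from \<open>shrunk n\<close> to \<open>x n\<close>.
\<close>

lemma asymptotic_regularity:
  assumes beta_lim: "\<beta> \<longlonglongrightarrow> 1"
    and lam_liminf: "liminf (\<lambda>n. ereal (lam n)) > 0"
    and increments: "(\<lambda>n. norm (x (Suc n) - x n)) \<longlonglongrightarrow> 0"
  shows "(\<lambda>n. norm (x n - T n (x n))) \<longlonglongrightarrow> 0"
proof -
  obtain \<delta> where \<delta>: "0 < \<delta>" "ereal \<delta> < liminf (\<lambda>n. ereal (lam n))"
    using ereal_dense2[OF lam_liminf] by auto
  have ev: "\<forall>\<^sub>F n in sequentially. \<delta> < lam n"
    using less_LiminfD[OF \<delta>(2)] by simp
  let ?s = "\<lambda>n. norm (shrunk n - x n)"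
  let ?g = "\<lambda>n. 2 * ?s n + (norm (x (Suc n) - x n) + ?s n) / \<delta>"
  have "?g \<longlonglongrightarrow> 2 * 0 + (0 + 0) / \<delta>"
    using \<delta>(1) by (intro tendsto_intros increments shrunk_minus_x_tendsto_0 beta_lim) auto
  then have lim: "?g \<longlonglongrightarrow> 0" by simp
  have "\<forall>\<^sub>F n in sequentially. norm (x n - T n (x n)) \<le> ?g n"
    using ev
  proof eventually_elim
    case (elim n)
    have "lam n *\<^sub>R (T n (shrunk n) - shrunk n) = (x (Suc n) - x n) - (shrunk n - x n)"
      by (simp add: x_Suc relaxed_def)
    then have "lam n * norm (T n (shrunk n) - shrunk n) \<le> norm (x (Suc n) - x n) + ?s n"
      using norm_triangle_ineq4[of "x (Suc n) - x n" "shrunk n - x n"] lam_range[of n]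
      by (metis abs_of_pos norm_scaleR)
    moreover have "\<delta> * norm (T n (shrunk n) - shrunk n) \<le> lam n * norm (T n (shrunk n) - shrunk n)"
      using elim by (intro mult_right_mono) auto
    ultimately have "norm (T n (shrunk n) - shrunk n) \<le> (norm (x (Suc n) - x n) + ?s n) / \<delta>"
      using \<delta>(1) by (simp add: pos_le_divide_eq mult.commute)
    moreover have "norm (T n (shrunk n) - T n (x n)) \<le> ?s n" by (rule nonexpansiveD[OF nonexp])
    moreover have "norm (x n - T n (x n)) \<le> norm (T n (shrunk n) - T n (x n))
        + norm (T n (shrunk n) - shrunk n) + ?s n"
    proof -
      define u v w where "u = T n (shrunk n) - T n (x n)"
        and "v = T n (shrunk n) - shrunk n" and "w = shrunk n - x n"
      have "norm (x n - T n (x n)) = norm (u - v - w)" by (simp add: u_def v_def w_def)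
      also have "\<dots> \<le> norm u + norm v + norm w"
        using norm_triangle_ineq4[of "u - v" w] norm_triangle_ineq4[of u v] by linarith
      finally show ?thesis by (simp only: u_def v_def w_def)
    qed
    ultimately show ?case by linarith
  qed
  then show ?thesis by (intro tendsto_sandwich[OF _ _ tendsto_const lim]) auto
qed

text \<open>
  Expanding \<open>\<parallel>\<beta> n *\<^sub>R (x n - p) - (1 - \<beta> n) *\<^sub>R p\<parallel>\<^sup>2\<close> shows that the squared distance to \<open>p\<close> obeys
  a contractive recursion whose forcing term is \<open>1 - \<beta> n\<close> times a quantity that differs from
  \<open>2 * inner p (p - x n)\<close> by a null sequence. The factor \<open>1 - \<beta> n\<close> is not summable, so the sign of this inner
  product is what decides convergence.
\<close>

lemma convergence_from_limsup_inner:
  assumes p: "p \<in> (\<Inter>n. Fix (T n))"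
    and beta_lim: "\<beta> \<longlonglongrightarrow> 1"
    and beta_sum: "filterlim (\<lambda>N. \<Sum>n<N. 1 - \<beta> n) at_top sequentially"
    and limsup: "\<And>\<epsilon>. 0 < \<epsilon> \<Longrightarrow> \<forall>\<^sub>F n in sequentially. inner p (p - x n) \<le> \<epsilon>"
  shows "x \<longlonglongrightarrow> p"
proof -
  define b where "b n = 2 * \<beta> n * inner p (p - x n) + (1 - \<beta> n) * (norm p)\<^sup>2" for n
  have "(\<lambda>n. (norm (x n - p))\<^sup>2) \<longlonglongrightarrow> 0"
  proof (rule perturbed_contraction_tendsto_0[where \<gamma> = "\<lambda>n. 1 - \<beta> n" and b = b and e = "\<lambda>_. 0"])
    fix n
    have r: "0 \<le> \<beta> n" "\<beta> n \<le> 1" using beta_range[of n] by auto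
    have "(norm (x (Suc n) - p))\<^sup>2 \<le> (norm (shrunk n - p))\<^sup>2"
      by (intro power_mono dist_fixed_point_step p) simp
    also have "\<dots> = (norm (\<beta> n *\<^sub>R (x n - p) - (1 - \<beta> n) *\<^sub>R p))\<^sup>2"
      by (simp add: shrunk_def algebra_simps)
    also have "\<dots> = \<beta> n * (\<beta> n * (norm (x n - p))\<^sup>2) + (1 - \<beta> n) * b n"
      unfolding b_def power2_norm_eq_inner
      by (simp add: inner_simps inner_commute power2_eq_square algebra_simps)
    also have "\<dots> \<le> \<beta> n * (norm (x n - p))\<^sup>2 + (1 - \<beta> n) * b n"
      using r by (intro add_right_mono mult_left_mono mult_left_le_one_le) auto
    finally show "(norm (x (Suc n) - p))\<^sup>2
        \<le> (1 - (1 - \<beta> n)) * (norm (x n - p))\<^sup>2 + (1 - \<beta> n) * b n + 0" by simp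
    show "0 \<le> 1 - \<beta> n \<and> 1 - \<beta> n \<le> 1" using r by simp
  next
    fix \<epsilon> :: real assume "0 < \<epsilon>"
    have "(\<lambda>n. (1 - \<beta> n) * (norm p)\<^sup>2) \<longlonglongrightarrow> (1 - 1) * (norm p)\<^sup>2"
      by (intro tendsto_intros beta_lim)
    then have "\<forall>\<^sub>F n in sequentially. (1 - \<beta> n) * (norm p)\<^sup>2 < \<epsilon> / 2"
      using \<open>0 < \<epsilon>\<close> by (intro order_tendstoD(2)) auto
    moreover have "\<forall>\<^sub>F n in sequentially. inner p (p - x n) \<le> \<epsilon> / 4"
      using \<open>0 < \<epsilon>\<close> by (intro limsup) simp
    ultimately show "\<forall>\<^sub>F n in sequentially. b n \<le> \<epsilon>"
    proof eventually_elim
      case (elim n)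
      have "\<beta> n * inner p (p - x n) \<le> \<beta> n * (\<epsilon> / 4)"
        using beta_range[of n] elim by (intro mult_left_mono) auto
      also have "\<dots> \<le> \<epsilon> / 4"
        using beta_range[of n] \<open>0 < \<epsilon>\<close> by (intro mult_left_le_one_le) auto
      finally show ?case using elim by (simp add: b_def)
    qed
  qed (use beta_sum in simp_all)
  then have "(\<lambda>n. norm (x n - p)) \<longlonglongrightarrow> 0"
    using tendsto_real_sqrt[of "\<lambda>n. (norm (x n - p))\<^sup>2" 0] by simp
  then show ?thesis by (simp add: LIM_zero_iff tendsto_norm_zero_iff)
qed

text \<open>
  If the inner products exceeded \<open>\<epsilon>\<close> infinitely often, a weakly convergent subsequence of those terms
  would have a limit \<open>z\<close> with \<open>\<epsilon> \<le> inner p (p - z)\<close>, against the assumed sign at weak cluster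
  points.
\<close>

lemma limsup_inner_of_weak_clusters:
  assumes clusters: "\<And>r z. strict_mono r \<Longrightarrow> (\<lambda>k. x (r k)) \<rightharpoonup> z \<Longrightarrow> 0 \<le> inner p (z - p)"
    and "0 < \<epsilon>"
  shows "\<forall>\<^sub>F n in sequentially. inner p (p - x n) \<le> \<epsilon>"
proof (rule ccontr)
  assume "\<not> ?thesis"
  then obtain r :: "nat \<Rightarrow> nat" where r: "strict_mono r" "\<And>n. \<not> inner p (p - x (r n)) \<le> \<epsilon>"
    using not_eventually_sequentiallyD by metis
  obtain M where "\<And>n. norm (x n) \<le> M" using x_bounded by blast
  then obtain s z where s: "strict_mono s" "(\<lambda>k. x (r (s k))) \<rightharpoonup> z"
    using bounded_imp_weakly_convergent_subsequence[of "\<lambda>n. x (r n)"] by blast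
  have "0 \<le> inner p (z - p)"
    using clusters[of "r \<circ> s" z] strict_mono_o[OF r(1) s(1)] s(2) by (simp add: o_def)
  moreover have "(\<lambda>k. inner (x (r (s k))) p) \<longlonglongrightarrow> inner z p"
    using s(2) by (simp add: weakly_tendsto_def)
  then have "(\<lambda>k. inner p p - inner (x (r (s k))) p) \<longlonglongrightarrow> inner p p - inner z p"
    by (rule tendsto_diff[OF tendsto_const])
  then have "\<epsilon> \<le> inner p p - inner z p"
    by (rule LIMSEQ_le_const)
      (use r(2) in \<open>auto simp: inner_diff_right inner_commute not_le intro: less_imp_le\<close>)
  ultimately show False using \<open>0 < \<epsilon>\<close> by (simp add: inner_diff_right inner_commute)
qed

end

theorem theorem1:
  fixes T :: "nat \<Rightarrow> 'a::{real_inner, complete_space} \<Rightarrow> 'a"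
    and x :: "nat \<Rightarrow> 'a"
    and \<beta> lam :: "nat \<Rightarrow> real"
    and S :: "'a set"
  assumes S_def: "S = (\<Inter>n. Fix (T n))"
    and nonexp: "\<And>n. nonexpansive (T n)"
    and S_nonempty: "S \<noteq> {}"
    and iter: "\<And>n. x (Suc n) =
      \<beta> n *\<^sub>R x n + lam n *\<^sub>R (T n (\<beta> n *\<^sub>R x n) - \<beta> n *\<^sub>R x n)"
    and beta_range: "\<And>n. 0 < \<beta> n \<and> \<beta> n \<le> 1"
    and beta_lim: "\<beta> \<longlonglongrightarrow> 1"
    and beta_sum: "filterlim (\<lambda>N. \<Sum>n<N. 1 - \<beta> n) at_top sequentially"
    and beta_var: "summable (\<lambda>n. \<bar>\<beta> (Suc n) - \<beta> n\<bar>)"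
    and lambda_range: "\<And>n. 0 < lam n \<and> lam n \<le> 1"
    and lambda_liminf: "liminf (\<lambda>n. ereal (lam n)) > 0"
    and lambda_var: "summable (\<lambda>n. \<bar>lam (Suc n) - lam n\<bar>)"
    and T_var: "summable (\<lambda>n. norm (T (Suc n) (\<beta> n *\<^sub>R x n) - T n (\<beta> n *\<^sub>R x n)))"
  shows "(\<lambda>n. norm (x n - T n (x n))) \<longlonglongrightarrow> 0 \<and>
    ((\<forall>r z. strict_mono r \<longrightarrow> (\<lambda>k. x (r k)) \<rightharpoonup> z \<longrightarrow>
        (\<lambda>k. x (r k) - T (r k) (x (r k))) \<longlonglongrightarrow> 0 \<longrightarrow> z \<in> (\<Inter>n. Fix (T n)))
      \<longrightarrow> x \<longlonglongrightarrow> metric_projection S 0)"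
proof -
  interpret tikhonov_krasnoselskii_mann T x \<beta> lam
    by standard (use nonexp S_nonempty iter beta_range lambda_range in \<open>auto simp: S_def\<close>)
  have regular: "(\<lambda>n. norm (x n - T n (x n))) \<longlonglongrightarrow> 0"
    by (intro asymptotic_regularity increments_tendsto_0 beta_lim lambda_liminf
        beta_sum beta_var lambda_var T_var[folded shrunk_def])
  let ?p = "metric_projection S 0"
  have "closed S" "convex S"
    unfolding S_def
    by (auto intro!: closed_INT convex_INT closed_Fix_nonexpansive convex_Fix_nonexpansive nonexp)
  note projection = metric_projection_variational[where x = 0, OF this S_nonempty]
  have "x \<longlonglongrightarrow> ?p"
    if clusters: "\<forall>r z. strict_mono r \<longrightarrow> (\<lambda>k. x (r k)) \<rightharpoonup> z \<longrightarrow>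
        (\<lambda>k. x (r k) - T (r k) (x (r k))) \<longlonglongrightarrow> 0 \<longrightarrow> z \<in> (\<Inter>n. Fix (T n))"
  proof (rule convergence_from_limsup_inner[OF _ beta_lim beta_sum limsup_inner_of_weak_clusters])
    show "?p \<in> (\<Inter>n. Fix (T n))" using projection(1) by (simp add: S_def)
    fix r z assume r: "strict_mono r" "(\<lambda>k. x (r k)) \<rightharpoonup> z"
    have "(\<lambda>k. x (r k) - T (r k) (x (r k))) \<longlonglongrightarrow> 0"
      using LIMSEQ_subseq_LIMSEQ[OF regular r(1)] by (simp add: o_def tendsto_norm_zero_iff)
    then have "z \<in> S" using clusters r by (simp add: S_def)
    then show "0 \<le> inner ?p (z - ?p)" using projection(2) by simp
  qed
  with regular show ?thesis by blast
qed

end
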